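(* Let $\psi_1,\psi_2:\mathcal{H}\to\mathbb{R}$ be convex functions of class $C^2$ such that $\|\nabla\psi_1(z)\|=\|\nabla\psi_2(z)\|$ for all $z\in\mathcal{H}$ and $\inf_{z\in\mathcal{H}}\|\nabla\psi_1(z)\|=0$ (the latter assumption holds whenever $\psi_1$ or $\psi_2$ is bounded below). Then $\psi_1=\psi_2+c$ for some constant $c\in\mathbb{R}$.
   Context: $\mathcal{H}$ is a real Hilbert space with norm $\|\cdot\|$; $\nabla$ denotes the gradient. *)

theory Defs
  imports "HOL-Analysis.Analysis"
begin

definition C2 :: "('a::real_normed_vector \<Rightarrow> 'b::real_normed_vector) \<Rightarrow> bool"
  where "C2 f \<longleftrightarrow>
    (\<exists>(f' :: 'a \<Rightarrow> 'a \<Rightarrow>\<^sub>L 'b) (f'' :: 'a \<Rightarrow> 'a \<Rightarrow>\<^sub>L 'a \<Rightarrow>\<^sub>L 'b).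
      (\<forall>x. (f has_derivative blinfun_apply (f' x)) (at x)) \<and>
      (\<forall>x. (f' has_derivative blinfun_apply (f'' x)) (at x)) \<and>
      continuous_on UNIV f'')"

text \<open>\<open>GDERIV f x :> D\<close> says that \<open>\<lambda>h. h \<bullet> D\<close> is the Frechet derivative of \<open>f\<close> at \<open>x\<close>;
  such a \<open>D\<close> is unique, and on a Hilbert space it exists wherever \<open>f\<close> is differentiable.\<close>

definition grad :: "('a::real_inner \<Rightarrow> real) \<Rightarrow> 'a \<Rightarrow> 'a"
  where "grad f x = (THE D. GDERIV f x :> D)"

end

theory Submission
  imports Defs
begin

text \<open>
  Write \<open>u\<close>, \<open>v\<close> for the two functions and \<open>w = \<nabla>v - \<nabla>u\<close>. Differentiating
  \<open>\<parallel>\<nabla>u\<parallel>\<^sup>2 = \<parallel>\<nabla>v\<parallel>\<^sup>2\<close> and using that Hessians are symmetric gives \<open>D\<^sup>2u \<nabla>u = D\<^sup>2v \<nabla>v\<close>.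
  Hence in the direction \<open>- \<nabla>u\<close> of steepest descent of \<open>u\<close> the derivative of \<open>w\<close> is
  \<open>D\<^sup>2u \<nabla>u - D\<^sup>2v \<nabla>u = D\<^sup>2v w\<close>, and that of \<open>\<parallel>w\<parallel>\<^sup>2\<close> is \<open>2 \<langle>D\<^sup>2v w, w\<rangle> \<ge> 0\<close> because \<open>v\<close> is
  convex. So \<open>\<parallel>w\<parallel>\<close> grows along the gradient flow of \<open>u\<close>; but \<open>\<parallel>w\<parallel> \<le> 2 \<parallel>\<nabla>u\<parallel>\<close>, and the flow
  drives \<open>\<parallel>\<nabla>u\<parallel>\<close> to its infimum \<open>0\<close>. Therefore \<open>w = 0\<close> everywhere and \<open>u - v\<close> is constant.

  The flow itself is never constructed. What it would achieve in infinite time is obtained at a single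
  point from Ekeland's variational principle: \<open>equal_gradient_norms_imp_equal_gradients\<close> applies
  it to the functional \<open>1 / (1 + \<parallel>w\<parallel>\<^sup>2) + \<kappa> u + \<kappa>\<^sup>2 \<parallel>\<cdot> - q\<parallel>\<^sup>2\<close>, whose first term decreases along
  \<open>- \<nabla>u\<close>, where \<open>q\<close> has small gradient. The resulting almost minimal point \<open>x\<close> must have
  small \<open>\<nabla>u x\<close>, hence small \<open>w x\<close>, and comparing the values of the functional at \<open>x\<close> and at a
  given \<open>p\<close> bounds \<open>w p\<close>.

  Ekeland's principle also yields the remaining ingredients: a function that is bounded below has almost
  critical points (\<open>almost_critical_point\<close>), which settles the second claim of the theorem, and
  applied to \<open>\<parallel>x\<parallel>\<^sup>2 - 2 l x\<close> this proves the Riesz representation theorem, which supplies gradients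
  and makes them differentiable.
\<close>

section \<open>Ekeland's variational principle\<close>

text \<open>
  In a complete space a bounded below continuous function need not attain its minimum, but it does so
  after adding an arbitrarily small cone with apex at the minimizer. The relation \<open>y \<in> S x\<close> is a
  preorder with closed sections along which \<open>\<Phi>\<close> decreases at least at the rate \<open>\<sigma>\<close>, so a greedily
  decreasing chain has finite length, and its limit admits no further descent.
\<close>

theorem ekeland_variational_principle:
  fixes \<Phi> :: "'a::complete_space \<Rightarrow> real"
  assumes cont: "continuous_on UNIV \<Phi>" and bdd: "bdd_below (range \<Phi>)" and \<sigma>: "\<sigma> > 0"
  obtains x where "\<Phi> x \<le> \<Phi> p" and "\<And>y. \<Phi> x - \<sigma> * dist x y \<le> \<Phi> y"
proof -
  define S where "S x = {y. \<Phi> y + \<sigma> * dist x y \<le> \<Phi> x}" for x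
  have S_self: "x \<in> S x" for x by (simp add: S_def)
  have S_trans: "z \<in> S x" if "y \<in> S x" "z \<in> S y" for x y z
  proof -
    have "\<sigma> * dist x z \<le> \<sigma> * dist x y + \<sigma> * dist y z"
      using mult_left_mono[OF dist_triangle[of x z y]] \<sigma> by (simp add: distrib_left)
    then show ?thesis using that by (simp add: S_def)
  qed
  have almost_min: "\<exists>y. y \<in> S x \<and> (\<forall>z\<in>S x. \<Phi> y \<le> \<Phi> z + inverse (real (Suc n)))" for x n
  proof -
    have ne: "\<Phi> ` S x \<noteq> {}" using S_self by blast
    have b: "bdd_below (\<Phi> ` S x)" using bdd by (rule bdd_below_mono) auto
    have "Inf (\<Phi> ` S x) < Inf (\<Phi> ` S x) + inverse (real (Suc n))" by simp
    then obtain y where "y \<in> S x" "\<Phi> y < Inf (\<Phi> ` S x) + inverse (real (Suc n))"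
      using cInf_lessD[OF ne] by blast
    moreover have "Inf (\<Phi> ` S x) \<le> \<Phi> z" if "z \<in> S x" for z
      using that b by (intro cInf_lower) auto
    ultimately show ?thesis by (intro exI[of _ y]) (auto intro: order_trans less_imp_le)
  qed
  have "\<exists>X. X 0 = p \<and> (\<forall>n. X (Suc n) \<in> S (X n) \<and>
      (\<forall>z\<in>S (X n). \<Phi> (X (Suc n)) \<le> \<Phi> z + inverse (real (Suc n))))"
    using dependent_nat_choice[of "\<lambda>n x. n = 0 \<longrightarrow> x = p"
      "\<lambda>n x y. y \<in> S x \<and> (\<forall>z\<in>S x. \<Phi> y \<le> \<Phi> z + inverse (real (Suc n)))"] almost_min
    by (metis nat.simps(3))
  then obtain X where X0: "X 0 = p" and step: "\<And>n. X (Suc n) \<in> S (X n)"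
    and almost: "\<And>n z. z \<in> S (X n) \<Longrightarrow> \<Phi> (X (Suc n)) \<le> \<Phi> z + inverse (real (Suc n))"
    by blast
  have X_S: "X n \<in> S (X m)" if "m \<le> n" for m n
    using that by (induction rule: dec_induct) (auto intro: S_self S_trans step)
  have decr: "\<sigma> * dist (X m) (X n) \<le> \<Phi> (X m) - \<Phi> (X n)" if "m \<le> n" for m n
    using X_S[OF that] by (simp add: S_def)
  have "\<Phi> (X n) \<le> \<Phi> (X m)" if "m \<le> n" for m n
  proof -
    have "0 \<le> \<sigma> * dist (X m) (X n)" using \<sigma> by simp
    then show ?thesis using decr[OF that] by linarith
  qed
  then have "decseq (\<lambda>n. \<Phi> (X n))" by (simp add: decseq_def)
  moreover obtain b where "\<And>x. b \<le> \<Phi> x" using bdd by (auto simp: bdd_below_def)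
  ultimately obtain L where "(\<lambda>n. \<Phi> (X n)) \<longlonglongrightarrow> L"
    using decseq_convergent by blast
  then have Cauchy_\<Phi>: "Cauchy (\<lambda>n. \<Phi> (X n))" by (rule LIMSEQ_imp_Cauchy)
  have "Cauchy X"
  proof (rule metric_CauchyI)
    fix e :: real assume "e > 0"
    then obtain M where M: "\<And>m n. m \<ge> M \<Longrightarrow> n \<ge> M \<Longrightarrow> dist (\<Phi> (X m)) (\<Phi> (X n)) < \<sigma> * e"
      using metric_CauchyD[OF Cauchy_\<Phi>, of "\<sigma> * e"] \<sigma> by auto
    have *: "dist (X m) (X n) < e" if "M \<le> m" "m \<le> n" for m n
    proof -
      have "\<sigma> * dist (X m) (X n) < \<sigma> * e"
        using decr[OF that(2)] M[of m n] that by (auto simp: dist_real_def)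
      then show ?thesis using \<sigma> by simp
    qed
    have "dist (X m) (X n) < e" if "M \<le> m" "M \<le> n" for m n
      using *[of m n] *[of n m] that by (cases "m \<le> n") (auto simp: dist_commute)
    then show "\<exists>M. \<forall>m\<ge>M. \<forall>n\<ge>M. dist (X m) (X n) < e" by blast
  qed
  then obtain x where x: "X \<longlonglongrightarrow> x" using Cauchy_convergent convergentD by blast
  have \<Phi>x: "(\<lambda>n. \<Phi> (X n)) \<longlonglongrightarrow> \<Phi> x"
    using continuous_on_tendsto_compose[OF cont x] by simp
  have x_S: "x \<in> S (X m)" for m
  proof -
    have "(\<lambda>n. \<Phi> (X n) + \<sigma> * dist (X m) (X n)) \<longlonglongrightarrow> \<Phi> x + \<sigma> * dist (X m) x"
      by (intro tendsto_intros \<Phi>x x)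
    then have "\<Phi> x + \<sigma> * dist (X m) x \<le> \<Phi> (X m)"
      by (rule LIMSEQ_le_const2) (use X_S in \<open>auto simp: S_def\<close>)
    then show ?thesis by (simp add: S_def)
  qed
  show thesis
  proof
    have "0 \<le> \<sigma> * dist p x" using \<sigma> by simp
    then show "\<Phi> x \<le> \<Phi> p" using x_S[of 0] X0 by (simp add: S_def)
    \<comment> \<open>A point violating the bound lies in every \<open>S (X n)\<close>, so the greedy choice already went as
      low as its value.\<close>
    fix y show "\<Phi> x - \<sigma> * dist x y \<le> \<Phi> y"
    proof (rule ccontr)
      assume neg: "\<not> ?thesis"
      then have "y \<in> S x" by (simp add: S_def)
      then have "\<Phi> (X (Suc n)) \<le> \<Phi> y + inverse (real (Suc n))" for n
        using almost S_trans x_S by blast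
      then have "\<Phi> x \<le> \<Phi> y + 0"
        using LIMSEQ_le[OF LIMSEQ_Suc[OF \<Phi>x] tendsto_add[OF tendsto_const LIMSEQ_inverse_real_of_nat]]
        by blast
      then show False using neg \<sigma> by (simp add: not_le) (smt (verit) mult_nonneg_nonneg zero_le_dist)
    qed
  qed
qed

lemma has_vector_derivative_along_line:
  assumes "(f has_derivative f') (at x)"
  shows "((\<lambda>t. f (x + t *\<^sub>R h)) has_vector_derivative f' h) (at 0)"
proof -
  interpret f': bounded_linear f' using assms by (rule has_derivative_bounded_linear)
  have "((\<lambda>t. x + t *\<^sub>R h) has_derivative (\<lambda>t. t *\<^sub>R h)) (at 0)"
    by (auto intro!: derivative_eq_intros)
  moreover have "(f has_derivative f') (at (x + 0 *\<^sub>R h))" using assms by simp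
  ultimately have "((\<lambda>t. f (x + t *\<^sub>R h)) has_derivative (\<lambda>t. f' (t *\<^sub>R h))) (at 0)"
    by (rule has_derivative_compose)
  then show ?thesis by (simp add: has_vector_derivative_def f'.scaleR)
qed

text \<open>
  This one-sided bound is how points found by Ekeland's principle are used: no direction descends faster
  than the slope of the cone.
\<close>

lemma ekeland_point_derivative_ge:
  fixes \<Phi> :: "'a::real_normed_vector \<Rightarrow> real"
  assumes der: "(\<Phi> has_derivative \<Phi>') (at x)" and min: "\<And>y. \<Phi> x - \<sigma> * dist x y \<le> \<Phi> y"
  shows "- \<sigma> * norm h \<le> \<Phi>' h"
proof (rule ccontr)
  assume "\<not> ?thesis"
  then have neg: "\<Phi>' h + \<sigma> * norm h < 0" by simp
  have "((\<lambda>t. \<Phi> (x + t *\<^sub>R h)) has_real_derivative \<Phi>' h) (at 0)"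
    using has_vector_derivative_along_line[OF der]
    by (simp add: has_real_derivative_iff_has_vector_derivative)
  then have "((\<lambda>t. \<Phi> (x + t *\<^sub>R h) + \<sigma> * (t * norm h)) has_real_derivative (\<Phi>' h + \<sigma> * norm h)) (at 0)"
    by (auto intro!: derivative_eq_intros)
  from DERIV_neg_dec_right[OF this neg] obtain d where "d > 0"
    and d: "\<And>t. 0 < t \<Longrightarrow> t < d \<Longrightarrow> \<Phi> (x + t *\<^sub>R h) + \<sigma> * (t * norm h) < \<Phi> x"
    by auto
  have "\<Phi> x - \<sigma> * dist x (x + (d/2) *\<^sub>R h) \<le> \<Phi> (x + (d/2) *\<^sub>R h)" by (rule min)
  moreover have "dist x (x + (d/2) *\<^sub>R h) = (d/2) * norm h"
    using \<open>d > 0\<close> by (simp add: dist_norm)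
  ultimately show False using d[of "d/2"] \<open>d > 0\<close> by simp
qed

text \<open>
  A substitute for critical points where no minimizer exists: \<open>\<Phi> x = exp x\<close> on the real line is the
  typical example.
\<close>

lemma almost_critical_point:
  fixes \<Phi> :: "'a::{real_normed_vector, complete_space} \<Rightarrow> real"
  assumes der: "\<And>x. (\<Phi> has_derivative \<Phi>' x) (at x)" and bdd: "bdd_below (range \<Phi>)" and "\<sigma> > 0"
  obtains x where "\<And>h. \<bar>\<Phi>' x h\<bar> \<le> \<sigma> * norm h"
proof -
  have "continuous_on UNIV \<Phi>"
    using der by (intro has_derivative_continuous_on) (auto intro: has_derivative_at_withinI)
  then obtain x where x: "\<And>y. \<Phi> x - \<sigma> * dist x y \<le> \<Phi> y"
    using ekeland_variational_principle bdd \<open>\<sigma> > 0\<close> by metis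
  interpret \<Phi>': bounded_linear "\<Phi>' x" using der by (rule has_derivative_bounded_linear)
  have "\<bar>\<Phi>' x h\<bar> \<le> \<sigma> * norm h" for h
    using ekeland_point_derivative_ge[OF der x, of h] ekeland_point_derivative_ge[OF der x, of "- h"]
    by (simp add: \<Phi>'.neg)
  then show thesis by (rule that)
qed

section \<open>Gradients and Hessians on a Hilbert space\<close>

text \<open>
  The representing vector is the critical point of \<open>\<parallel>x\<parallel>\<^sup>2 - 2 l x\<close>. The derivative of this quadratic
  function determines its argument isometrically up to the factor 2, so almost critical points form a Cauchy sequence.
\<close>

theorem riesz_representation:
  fixes l :: "'a::{real_inner, complete_space} \<Rightarrow> real"
  assumes "bounded_linear l"
  obtains y where "\<And>h. l h = inner h y"
proof -
  interpret l: bounded_linear l by fact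
  obtain K where K: "\<And>x. norm (l x) \<le> norm x * K" using l.nonneg_bounded by blast
  define \<Phi> where "\<Phi> x = inner x x - 2 * l x" for x
  have der: "(\<Phi> has_derivative (\<lambda>h. 2 * (inner h x - l h))) (at x)" for x
    unfolding \<Phi>_def
    by (auto intro!: derivative_eq_intros bounded_linear.has_derivative[OF assms] simp: inner_commute algebra_simps)
  have "- K\<^sup>2 \<le> \<Phi> x" for x
  proof -
    have "l x \<le> norm x * K" using K[of x] by simp
    moreover have "0 \<le> (norm x - K)\<^sup>2" by simp
    ultimately show ?thesis
      by (simp add: \<Phi>_def power2_diff flip: power2_norm_eq_inner)
  qed
  then have bdd: "bdd_below (range \<Phi>)" by (auto simp: bdd_below_def)
  have "\<exists>x. \<forall>h. \<bar>inner h x - l h\<bar> \<le> inverse (real (Suc n)) * norm h" for n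
  proof -
    obtain x where "\<And>h. \<bar>2 * (inner h x - l h)\<bar> \<le> (2 * inverse (real (Suc n))) * norm h"
      using almost_critical_point[OF der bdd, of "2 * inverse (real (Suc n))"] by auto
    then have "2 * \<bar>inner h x - l h\<bar> \<le> 2 * (inverse (real (Suc n)) * norm h)" for h
      by (metis abs_mult abs_numeral mult.assoc)
    then show ?thesis by (intro exI[of _ x]) (simp del: of_nat_Suc)
  qed
  then obtain X where X: "\<And>n h. \<bar>inner h (X n) - l h\<bar> \<le> inverse (real (Suc n)) * norm h" by metis
  have close: "norm (X m - X n) \<le> inverse (real (Suc m)) + inverse (real (Suc n))" for m n
  proof (cases "X m = X n")
    case False
    let ?d = "X m - X n"
    have "norm ?d * norm ?d = inner ?d (X m) - inner ?d (X n)"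
      by (metis inner_diff_right dot_square_norm power2_eq_square)
    also have "\<dots> \<le> (inverse (real (Suc m)) + inverse (real (Suc n))) * norm ?d"
      using X[of ?d m] X[of ?d n] by (simp add: distrib_right)
    finally show ?thesis using False by (simp del: of_nat_Suc)
  qed simp
  have "Cauchy X"
  proof (rule metric_CauchyI)
    fix e :: real assume "e > 0"
    then obtain M where M: "inverse (real (Suc M)) < e/2" using reals_Archimedean[of "e/2"] by auto
    have "dist (X m) (X n) < e" if "m \<ge> M" "n \<ge> M" for m n
    proof -
      have "inverse (real (Suc m)) \<le> inverse (real (Suc M))" "inverse (real (Suc n)) \<le> inverse (real (Suc M))"
        using that by (auto intro!: le_imp_inverse_le)
      then show ?thesis using close[of m n] M unfolding dist_norm by linarith
    qed
    then show "\<exists>M. \<forall>m\<ge>M. \<forall>n\<ge>M. dist (X m) (X n) < e" by blast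
  qed
  then obtain y where y: "X \<longlonglongrightarrow> y" using Cauchy_convergent convergentD by blast
  have "l h = inner h y" for h
  proof -
    have "(\<lambda>n. \<bar>inner h (X n) - l h\<bar>) \<longlonglongrightarrow> \<bar>inner h y - l h\<bar>" by (intro tendsto_intros y)
    moreover have "(\<lambda>n. inverse (real (Suc n)) * norm h) \<longlonglongrightarrow> 0 * norm h"
      by (intro tendsto_mult LIMSEQ_inverse_real_of_nat tendsto_const)
    ultimately have "\<bar>inner h y - l h\<bar> \<le> 0 * norm h" using X by (intro LIMSEQ_le) auto
    then show ?thesis by simp
  qed
  then show thesis by (rule that)
qed

definition riesz :: "('a::{real_inner, complete_space} \<Rightarrow>\<^sub>L real) \<Rightarrow> 'a"
  where "riesz l = (SOME y. \<forall>h. blinfun_apply l h = inner h y)"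

lemma inner_riesz: "inner h (riesz l) = blinfun_apply l h"
proof -
  have "\<exists>y. \<forall>h. blinfun_apply l h = inner h y"
    using riesz_representation[OF blinfun.bounded_linear_right[of l]] by metis
  then have "\<forall>h. blinfun_apply l h = inner h (riesz l)" unfolding riesz_def by (rule someI_ex)
  then show ?thesis by simp
qed

text \<open>
  Since passing from a functional to its representing vector is bounded and linear, a differentiable
  derivative is the same as a differentiable gradient.
\<close>

lemma bounded_linear_riesz: "bounded_linear riesz"
proof (rule bounded_linear_intro[where K = 1])
  show "riesz (l + m) = riesz l + riesz m" for l m :: "'a \<Rightarrow>\<^sub>L real"
    by (subst vector_eq_ldot[symmetric]) (simp add: inner_add_right inner_riesz blinfun.add_left)
  show "riesz (r *\<^sub>R l) = r *\<^sub>R riesz l" for r and l :: "'a \<Rightarrow>\<^sub>L real"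
    by (subst vector_eq_ldot[symmetric]) (simp add: inner_riesz blinfun.scaleR_left)
  show "norm (riesz l) \<le> norm l * 1" for l :: "'a \<Rightarrow>\<^sub>L real"
  proof (cases "riesz l = 0")
    case False
    have "norm (riesz l) * norm (riesz l) = blinfun_apply l (riesz l)"
      by (simp flip: inner_riesz power2_norm_eq_inner power2_eq_square)
    also have "\<dots> \<le> norm l * norm (riesz l)" using norm_blinfun[of l "riesz l"] by simp
    finally show ?thesis using False by simp
  qed simp
qed

lemma grad_eqI: "grad f x = D" if "GDERIV f x :> D"
  unfolding grad_def
proof (rule the_equality)
  fix E assume "GDERIV f x :> E"
  with that have "(\<lambda>h. inner h E) = (\<lambda>h. inner h D)"
    unfolding gderiv_def by (rule has_derivative_unique[rotated])
  then have "\<forall>h. inner h E = inner h D" by metis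
  then show "E = D" by (simp add: vector_eq_ldot)
qed (rule that)

text \<open>
  The second difference of \<open>f\<close> over a small parallelogram with sides \<open>t h\<close> and \<open>t k\<close> is symmetric
  in \<open>h\<close> and \<open>k\<close>. Two applications of the mean value theorem turn it into \<open>t\<^sup>2\<close> times a second
  derivative inside the parallelogram, in either order, and continuity allows \<open>t \<rightarrow> 0\<close>.
\<close>

lemma second_derivative_symmetric:
  fixes f :: "'a::real_normed_vector \<Rightarrow> real"
  assumes f': "\<And>x. (f has_derivative blinfun_apply (f' x)) (at x)"
    and f'': "\<And>x. (f' has_derivative blinfun_apply (f'' x)) (at x)"
    and cont: "continuous_on UNIV f''"
  shows "blinfun_apply (blinfun_apply (f'' x) h) k = blinfun_apply (blinfun_apply (f'' x) k) h"
proof -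
  have square: "\<exists>a b. 0 < a \<and> a < t \<and> 0 < b \<and> b < t \<and>
      f (x + t *\<^sub>R h + t *\<^sub>R k) - f (x + t *\<^sub>R h) - f (x + t *\<^sub>R k) + f x
        = t * (t * f'' (x + a *\<^sub>R h + b *\<^sub>R k) k h)" if "t > 0" for t h k
  proof -
    have "DERIV (\<lambda>s. f (x + s *\<^sub>R h + t *\<^sub>R k) - f (x + s *\<^sub>R h)) s
        :> f' (x + s *\<^sub>R h + t *\<^sub>R k) h - f' (x + s *\<^sub>R h) h" for s
      unfolding has_field_derivative_def
      by (auto intro!: derivative_eq_intros has_derivative_compose[where g = f, OF _ f']
          simp: blinfun.scaleR_right algebra_simps)
    from MVT2[OF \<open>t > 0\<close> this] obtain a where a: "0 < a" "a < t"
      and eq1: "f (x + t *\<^sub>R h + t *\<^sub>R k) - f (x + t *\<^sub>R h) - (f (x + t *\<^sub>R k) - f x)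
        = t * (f' (x + a *\<^sub>R h + t *\<^sub>R k) h - f' (x + a *\<^sub>R h) h)" by auto
    have "DERIV (\<lambda>s. f' (x + a *\<^sub>R h + s *\<^sub>R k) h) s :> f'' (x + a *\<^sub>R h + s *\<^sub>R k) k h" for s
      unfolding has_field_derivative_def
      by (auto intro!: derivative_eq_intros has_derivative_compose[where g = f', OF _ f'']
          bounded_linear.has_derivative[OF blinfun.bounded_linear_left]
          simp: blinfun.scaleR_right blinfun.scaleR_left algebra_simps)
    from MVT2[OF \<open>t > 0\<close> this] obtain b where "0 < b" "b < t"
      "f' (x + a *\<^sub>R h + t *\<^sub>R k) h - f' (x + a *\<^sub>R h) h = t * f'' (x + a *\<^sub>R h + b *\<^sub>R k) k h" by auto
    then show ?thesis using a eq1 by (intro exI[of _ a] exI[of _ b]) auto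
  qed
  let ?A = "\<lambda>y. blinfun_apply (blinfun_apply (f'' y) k) h"
  let ?B = "\<lambda>y. blinfun_apply (blinfun_apply (f'' y) h) k"
  have isC: "isCont f'' x" using cont by (simp add: continuous_on_eq_continuous_at)
  define t where "t n = inverse (real (Suc n))" for n
  have t: "t n > 0" "t \<longlonglongrightarrow> 0" for n
    unfolding t_def using LIMSEQ_inverse_real_of_nat by auto
  have "\<exists>a b c d. \<bar>a\<bar> \<le> t n \<and> \<bar>b\<bar> \<le> t n \<and> \<bar>c\<bar> \<le> t n \<and> \<bar>d\<bar> \<le> t n \<and>
      ?A (x + a *\<^sub>R h + b *\<^sub>R k) = ?B (x + c *\<^sub>R k + d *\<^sub>R h)" for n
  proof -
    obtain a b where ab: "0 < a" "a < t n" "0 < b" "b < t n"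
      "f (x + t n *\<^sub>R h + t n *\<^sub>R k) - f (x + t n *\<^sub>R h) - f (x + t n *\<^sub>R k) + f x
        = t n * (t n * ?A (x + a *\<^sub>R h + b *\<^sub>R k))" using square[OF t(1)] by metis
    obtain c d where cd: "0 < c" "c < t n" "0 < d" "d < t n"
      "f (x + t n *\<^sub>R k + t n *\<^sub>R h) - f (x + t n *\<^sub>R k) - f (x + t n *\<^sub>R h) + f x
        = t n * (t n * ?B (x + c *\<^sub>R k + d *\<^sub>R h))" using square[OF t(1)] by metis
    have swap: "x + t n *\<^sub>R k + t n *\<^sub>R h = x + t n *\<^sub>R h + t n *\<^sub>R k" by simp
    have "t n * (t n * ?A (x + a *\<^sub>R h + b *\<^sub>R k)) = t n * (t n * ?B (x + c *\<^sub>R k + d *\<^sub>R h))"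
      using ab(5) cd(5)[unfolded swap] by linarith
    with t(1)[of n] have "?A (x + a *\<^sub>R h + b *\<^sub>R k) = ?B (x + c *\<^sub>R k + d *\<^sub>R h)" by simp
    then show ?thesis using ab cd
      by (intro exI[of _ a] exI[of _ b] exI[of _ c] exI[of _ d]) auto
  qed
  then obtain a b c d where small: "\<And>n. \<bar>a n\<bar> \<le> t n" "\<And>n. \<bar>b n\<bar> \<le> t n" "\<And>n. \<bar>c n\<bar> \<le> t n" "\<And>n. \<bar>d n\<bar> \<le> t n"
    and eq: "\<And>n. ?A (x + a n *\<^sub>R h + b n *\<^sub>R k) = ?B (x + c n *\<^sub>R k + d n *\<^sub>R h)" by metis
  have lim0: "r \<longlonglongrightarrow> 0" if "\<And>n. \<bar>r n\<bar> \<le> t n" for r :: "nat \<Rightarrow> real"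
    using that t(2) by (intro Lim_null_comparison[of r t]) auto
  have "(\<lambda>n. x + a n *\<^sub>R h + b n *\<^sub>R k) \<longlonglongrightarrow> x + 0 *\<^sub>R h + 0 *\<^sub>R k"
    by (intro tendsto_intros lim0 small)
  then have "(\<lambda>n. f'' (x + a n *\<^sub>R h + b n *\<^sub>R k)) \<longlonglongrightarrow> f'' x"
    by (intro isCont_tendsto_compose[OF isC]) simp
  then have A: "(\<lambda>n. ?A (x + a n *\<^sub>R h + b n *\<^sub>R k)) \<longlonglongrightarrow> ?A x"
    by (intro tendsto_intros)
  have "(\<lambda>n. x + c n *\<^sub>R k + d n *\<^sub>R h) \<longlonglongrightarrow> x + 0 *\<^sub>R k + 0 *\<^sub>R h"
    by (intro tendsto_intros lim0 small)
  then have "(\<lambda>n. f'' (x + c n *\<^sub>R k + d n *\<^sub>R h)) \<longlonglongrightarrow> f'' x"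
    by (intro isCont_tendsto_compose[OF isC]) simp
  then have B: "(\<lambda>n. ?B (x + c n *\<^sub>R k + d n *\<^sub>R h)) \<longlonglongrightarrow> ?B x"
    by (intro tendsto_intros)
  show ?thesis using LIMSEQ_unique[OF A] B eq by simp
qed

lemma C2_grad_Hessian:
  fixes f :: "'a::{real_inner, complete_space} \<Rightarrow> real"
  assumes "C2 f"
  obtains H where "\<And>x. GDERIV f x :> grad f x" and "\<And>x. (grad f has_derivative H x) (at x)"
    and "\<And>x h k. inner (H x h) k = inner (H x k) h"
proof -
  obtain f' f'' where f': "\<And>x. (f has_derivative blinfun_apply (f' x)) (at x)"
    and f'': "\<And>x. (f' has_derivative blinfun_apply (f'' x)) (at x)"
    and cont: "continuous_on UNIV f''"
    using assms unfolding C2_def by blast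
  have riesz: "GDERIV f x :> riesz (f' x)" for x
    using f'[of x] by (simp add: gderiv_def inner_riesz)
  have grad: "grad f = (\<lambda>x. riesz (f' x))" by (intro ext grad_eqI riesz)
  show thesis
  proof
    show "GDERIV f x :> grad f x" for x unfolding grad by (rule riesz)
    show "(grad f has_derivative (\<lambda>h. riesz (f'' x h))) (at x)" for x
      unfolding grad by (rule bounded_linear.has_derivative[OF bounded_linear_riesz f''])
    show "inner (riesz (f'' x h)) k = inner (riesz (f'' x k)) h" for x h k
      using second_derivative_symmetric[OF f' f'' cont]
      by (simp add: inner_commute[of "riesz _"] inner_riesz)
  qed
qed

lemma convex_above_tangent:
  fixes f :: "'a::real_inner \<Rightarrow> real"
  assumes "convex_on UNIV f" and der: "GDERIV f x :> D"
  shows "f x + inner (y - x) D \<le> f y"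
proof -
  let ?g = "\<lambda>t::real. f (x + t *\<^sub>R (y - x))"
  have "convex_on UNIV ?g"
  proof (rule convex_onI)
    fix t a b :: real assume "0 < t" "t < 1"
    have "x + ((1 - t) *\<^sub>R a + t *\<^sub>R b) *\<^sub>R (y - x)
        = (1 - t) *\<^sub>R (x + a *\<^sub>R (y - x)) + t *\<^sub>R (x + b *\<^sub>R (y - x))" by (simp add: algebra_simps)
    then show "?g ((1 - t) *\<^sub>R a + t *\<^sub>R b) \<le> (1 - t) * ?g a + t * ?g b"
      using convex_onD[OF assms(1), of t] \<open>0 < t\<close> \<open>t < 1\<close> by simp
  qed simp
  moreover have "(?g has_real_derivative inner (y - x) D) (at 0)"
    using has_vector_derivative_along_line[OF der[unfolded gderiv_def]]
    by (simp add: has_real_derivative_iff_has_vector_derivative)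
  ultimately have "?g 1 - ?g 0 \<ge> inner (y - x) D * (1 - 0)"
    by (intro convex_on_imp_above_tangent[of UNIV]) auto
  then show ?thesis by simp
qed

text \<open>
  Adding the tangent inequalities at two points shows that the gradient is monotone along every line;
  the derivative of this monotone function is the quadratic form of the Hessian.
\<close>

lemma convex_Hessian_nonneg:
  fixes f :: "'a::real_inner \<Rightarrow> real"
  assumes cvx: "convex_on UNIV f" and grad: "\<And>x. GDERIV f x :> g x"
    and Hess: "(g has_derivative H) (at x)"
  shows "0 \<le> inner (H h) h"
proof -
  let ?\<phi> = "\<lambda>t::real. inner (g (x + t *\<^sub>R h)) h"
  have mono: "?\<phi> s \<le> ?\<phi> t" if "s \<le> t" for s t
  proof (cases "s = t")
    case False
    let ?y = "x + s *\<^sub>R h" and ?z = "x + t *\<^sub>R h"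
    have "inner (?z - ?y) (g ?z - g ?y) \<ge> 0"
      using convex_above_tangent[OF cvx grad, of ?y ?z] convex_above_tangent[OF cvx grad, of ?z ?y]
      by (simp add: inner_diff_right inner_diff_left)
    moreover have "?z - ?y = (t - s) *\<^sub>R h" by (simp add: algebra_simps)
    ultimately have "0 \<le> inner ((t - s) *\<^sub>R h) (g ?z - g ?y)" by metis
    then have "0 \<le> (t - s) * (?\<phi> t - ?\<phi> s)"
      by (simp add: inner_diff_right right_diff_distrib inner_commute[of "g _"])
    then show ?thesis using that False by (simp add: zero_le_mult_iff)
  qed simp
  have "(?\<phi> has_real_derivative inner (H h) h) (at 0)"
    unfolding has_real_derivative_iff_has_vector_derivative
    by (rule bounded_linear.has_vector_derivative[OF bounded_linear_inner_left
        has_vector_derivative_along_line[OF Hess]])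
  then show ?thesis
    using mono by (intro mono_on_imp_deriv_nonneg[of UNIV ?\<phi>]) (auto intro: mono_onI)
qed

section \<open>Equal gradient norms\<close>

text \<open>
  The core of the argument. In the functional \<open>\<Phi>\<close> below the term \<open>\<kappa> u\<close> makes descent along
  \<open>- \<nabla>u\<close> strict, so that an Ekeland point has small gradient. As \<open>u\<close> may be unbounded below, the
  quadratic term is added; it compensates the decrease of \<open>u\<close>, which is at most linear with the small
  slope \<open>\<parallel>\<nabla>u q\<parallel>\<close>, and by convexity it grows along \<open>- \<nabla>u\<close> at most at the rate \<open>2 \<kappa>\<^sup>2 (u q - u x)\<close>.
  Passing from \<open>\<parallel>w\<parallel>\<^sup>2\<close> to \<open>1 / (1 + \<parallel>w\<parallel>\<^sup>2)\<close> makes the first term bounded and keeps its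
  monotonicity, reversed.
\<close>

lemma equal_gradient_norms_imp_equal_gradients:
  fixes u v :: "'a::{real_inner, complete_space} \<Rightarrow> real"
  assumes cvx: "convex_on UNIV u" "convex_on UNIV v"
    and grad: "\<And>x. GDERIV u x :> gu x" "\<And>x. GDERIV v x :> gv x"
    and Hess: "\<And>x. (gu has_derivative A x) (at x)" "\<And>x. (gv has_derivative B x) (at x)"
    and sym: "\<And>x h k. inner (A x h) k = inner (A x k) h" "\<And>x h k. inner (B x h) k = inner (B x k) h"
    and norm_eq: "\<And>x. norm (gu x) = norm (gv x)"
    and inf0: "\<And>e. e > 0 \<Longrightarrow> \<exists>q. norm (gu q) < e"
  shows "gu p = gv p"
proof -
  define w where "w x = gv x - gu x" for x
  have w_le: "(norm (w x))\<^sup>2 \<le> 4 * (norm (gu x))\<^sup>2" for x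
  proof -
    have "norm (w x) \<le> 2 * norm (gu x)"
      unfolding w_def using norm_triangle_ineq4[of "gv x" "gu x"] norm_eq[of x] by simp
    from power_mono[OF this, of 2] show ?thesis by (simp add: power_mult_distrib)
  qed
  have w_der: "(w has_derivative (\<lambda>h. B x h - A x h)) (at x)" for x
    unfolding w_def by (intro has_derivative_diff Hess)
  \<comment> \<open>Both sides represent half the derivative of \<open>\<parallel>\<nabla>u\<parallel>\<^sup>2 = \<parallel>\<nabla>v\<parallel>\<^sup>2\<close>.\<close>
  have Agu: "A x (gu x) = B x (gv x)" for x
  proof -
    have "((\<lambda>x. inner (gu x) (gu x)) has_derivative (\<lambda>h. 2 * inner (A x h) (gu x))) (at x)"
      by (auto intro!: derivative_eq_intros Hess simp: inner_commute)
    moreover have "((\<lambda>x. inner (gv x) (gv x)) has_derivative (\<lambda>h. 2 * inner (B x h) (gv x))) (at x)"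
      by (auto intro!: derivative_eq_intros Hess simp: inner_commute)
    moreover have "(\<lambda>x. inner (gu x) (gu x)) = (\<lambda>x. inner (gv x) (gv x))"
      using norm_eq by (simp flip: power2_norm_eq_inner)
    ultimately have "(\<lambda>h. 2 * inner (A x h) (gu x)) = (\<lambda>h. 2 * inner (B x h) (gv x))"
      using has_derivative_unique by metis
    then have "inner (A x h) (gu x) = inner (B x h) (gv x)" for h by (metis mult_cancel_left zero_neq_numeral)
    then have "\<forall>h. inner (A x (gu x)) h = inner (B x (gv x)) h" using sym by metis
    then show ?thesis by (simp add: vector_eq_rdot)
  qed
  \<comment> \<open>Half the derivative of \<open>\<parallel>w\<parallel>\<^sup>2\<close> in the direction \<open>- \<nabla>u\<close>.\<close>
  have w_grows: "0 \<le> inner (w x) (B x (- gu x) - A x (- gu x))" for x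
  proof -
    interpret B: bounded_linear "B x" using Hess(2) by (rule has_derivative_bounded_linear)
    interpret A: bounded_linear "A x" using Hess(1) by (rule has_derivative_bounded_linear)
    have "B x (- gu x) - A x (- gu x) = B x (w x)"
      by (simp add: A.neg B.neg Agu w_def B.diff)
    then show ?thesis using convex_Hessian_nonneg[OF cvx(2) grad(2) Hess(2), of x "w x"]
      by (simp add: inner_commute)
  qed
  \<comment> \<open>The scaling of the right-hand side matters: everything except the first summand vanishes as
    \<open>\<kappa> \<rightarrow> 0\<close> with \<open>q\<close> fixed, and the first one becomes small afterwards by the choice of \<open>q\<close>. The
    Ekeland slope and the weight of the quadratic term are both \<open>\<kappa>\<^sup>2\<close> for this purpose.\<close>
  have key: "1 - 1 / (1 + (norm (w p))\<^sup>2)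
      \<le> 73 * (norm (gu q))\<^sup>2 + \<kappa> * (u p - u q) + \<kappa>\<^sup>2 * ((norm (p - q))\<^sup>2 + 4)" if "\<kappa> > 0" for q \<kappa>
  proof -
    define \<epsilon> where "\<epsilon> = norm (gu q)"
    have u_ge: "u q - \<epsilon> * norm (x - q) \<le> u x" for x
      using convex_above_tangent[OF cvx(1) grad(1), of q x] Cauchy_Schwarz_ineq2[of "x - q" "gu q"]
      by (simp add: \<epsilon>_def mult.commute)
    define \<Phi> where "\<Phi> x = inverse (1 + inner (w x) (w x)) + \<kappa> * u x + \<kappa>\<^sup>2 * inner (x - q) (x - q)" for x
    have pos: "1 + inner (w x) (w x) > 0" for x by (simp add: add_pos_nonneg)
    define \<Phi>' where "\<Phi>' x h = - (2 * inner (w x) (B x h - A x h) / (1 + inner (w x) (w x))\<^sup>2)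
        + \<kappa> * inner h (gu x) + \<kappa>\<^sup>2 * (2 * inner h (x - q))" for x h
    have der: "(\<Phi> has_derivative \<Phi>' x) (at x)" for x
      unfolding \<Phi>_def \<Phi>'_def
      using grad(1)[of x, unfolded gderiv_def] pos[of x]
      by (auto intro!: derivative_eq_intros w_der simp: inner_commute power2_eq_square field_simps)
    have "\<kappa> * u q - \<epsilon>\<^sup>2 \<le> \<Phi> x" for x
    proof -
      have "\<kappa> * u q - \<kappa> * (\<epsilon> * norm (x - q)) \<le> \<kappa> * u x"
        using mult_left_mono[OF u_ge[of x], of \<kappa>] that by (simp add: right_diff_distrib)
      moreover have "\<kappa> * (\<epsilon> * norm (x - q)) \<le> \<kappa>\<^sup>2 * (norm (x - q))\<^sup>2 + \<epsilon>\<^sup>2"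
      proof -
        have "0 \<le> (\<kappa> * norm (x - q) - \<epsilon>)\<^sup>2" by simp
        moreover have "0 \<le> \<kappa> * (\<epsilon> * norm (x - q))" using that by (simp add: \<epsilon>_def)
        ultimately show ?thesis by (simp add: power2_diff power_mult_distrib mult_ac)
      qed
      moreover have "0 \<le> inverse (1 + inner (w x) (w x))" using pos[of x] by simp
      ultimately show ?thesis unfolding \<Phi>_def power2_norm_eq_inner by linarith
    qed
    then have bdd: "bdd_below (range \<Phi>)" by (auto simp: bdd_below_def)
    have "continuous_on UNIV \<Phi>"
      using der by (intro has_derivative_continuous_on) (auto intro: has_derivative_at_withinI)
    moreover have "\<kappa>\<^sup>2 > 0" using that by simp
    ultimately obtain x where le: "\<Phi> x \<le> \<Phi> p" and min: "\<And>y. \<Phi> x - \<kappa>\<^sup>2 * dist x y \<le> \<Phi> y"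
      using ekeland_variational_principle[OF _ bdd, of "\<kappa>\<^sup>2" p] by metis
    \<comment> \<open>At the Ekeland point the descent rate \<open>\<kappa> e\<^sup>2\<close> of \<open>\<kappa> u\<close> is bounded by the slope of the cone and the
      growth of the quadratic term, which controls \<open>e\<close>.\<close>
    define e where "e = norm (gu x)"
    define D where "D = norm (x - q)"
    define U where "U = u q - u x"
    have U: "U \<le> \<epsilon> * D" using u_ge[of x] by (simp add: U_def D_def)
    have "- \<kappa>\<^sup>2 * e \<le> \<Phi>' x (- gu x)"
      using ekeland_point_derivative_ge[OF der min, of "- gu x"] by (simp add: e_def)
    also have "\<dots> \<le> - (\<kappa> * e\<^sup>2) + \<kappa>\<^sup>2 * (2 * U)"
    proof -
      have "0 \<le> 2 * inner (w x) (B x (- gu x) - A x (- gu x)) / (1 + inner (w x) (w x))\<^sup>2"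
        using w_grows[of x] by simp
      moreover have "inner (- gu x) (x - q) \<le> U"
        using convex_above_tangent[OF cvx(1) grad(1), of x q]
        by (simp add: U_def inner_commute inner_diff_right inner_diff_left)
      then have "\<kappa>\<^sup>2 * (2 * inner (- gu x) (x - q)) \<le> \<kappa>\<^sup>2 * (2 * U)"
        by (intro mult_left_mono) auto
      moreover have "\<kappa> * inner (- gu x) (gu x) = - (\<kappa> * e\<^sup>2)"
        by (simp add: e_def power2_norm_eq_inner)
      ultimately show ?thesis unfolding \<Phi>'_def by linarith
    qed
    finally have "\<kappa> * e\<^sup>2 \<le> \<kappa> * (2 * (\<kappa> * U) + \<kappa> * e)"
      by (simp add: power2_eq_square algebra_simps)
    then have "e\<^sup>2 \<le> 2 * (\<kappa> * U) + \<kappa> * e" using that by simp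
    moreover have "2 * (\<kappa> * e) \<le> e\<^sup>2 + \<kappa>\<^sup>2"
      using sum_squares_bound[of \<kappa> e] by simp
    ultimately have e: "e\<^sup>2 \<le> 4 * (\<kappa> * U) + \<kappa>\<^sup>2" by linarith
    have "1 - 4 * e\<^sup>2 \<le> 1 - (norm (w x))\<^sup>2" using w_le[of x] by (simp add: e_def)
    also have "\<dots> \<le> inverse (1 + (norm (w x))\<^sup>2)"
    proof -
      have "(1 - (norm (w x))\<^sup>2) * (1 + (norm (w x))\<^sup>2) \<le> 1" by (simp add: algebra_simps)
      moreover have "0 < 1 + (norm (w x))\<^sup>2" by (simp add: add_pos_nonneg)
      ultimately show ?thesis by (simp add: inverse_eq_divide pos_le_divide_eq)
    qed
    finally have W: "1 - 4 * e\<^sup>2 \<le> inverse (1 + (norm (w x))\<^sup>2)" .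
    have "inverse (1 + (norm (w x))\<^sup>2) + \<kappa> * u x + \<kappa>\<^sup>2 * D\<^sup>2
        \<le> inverse (1 + (norm (w p))\<^sup>2) + \<kappa> * u p + \<kappa>\<^sup>2 * (norm (p - q))\<^sup>2"
      using le by (simp add: \<Phi>_def D_def power2_norm_eq_inner)
    \<comment> \<open>Of the 17 multiples of \<open>\<kappa> U\<close>, 16 come from \<open>4 e\<^sup>2\<close> and one from the change of \<open>\<kappa> u\<close>
      between \<open>q\<close> and \<open>x\<close>.\<close>
    then have "1 - inverse (1 + (norm (w p))\<^sup>2)
        \<le> 17 * (\<kappa> * U) - \<kappa>\<^sup>2 * D\<^sup>2 + \<kappa> * (u p - u q) + \<kappa>\<^sup>2 * ((norm (p - q))\<^sup>2 + 4)"
      using W e by (simp add: U_def algebra_simps)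
    moreover have "\<kappa> * U \<le> \<kappa> * (\<epsilon> * D)" using U that by (intro mult_left_mono) auto
    \<comment> \<open>The penalty \<open>\<kappa>\<^sup>2 D\<^sup>2\<close> absorbs the term that is linear in the unknown distance \<open>D\<close>: completing
      the square leaves \<open>(17/2)\<^sup>2 \<epsilon>\<^sup>2\<close>, independently of \<open>\<kappa>\<close>.\<close>
    moreover have "17 * (\<kappa> * (\<epsilon> * D)) - \<kappa>\<^sup>2 * D\<^sup>2 \<le> 73 * \<epsilon>\<^sup>2"
    proof -
      have "0 \<le> (\<kappa> * D - 17/2 * \<epsilon>)\<^sup>2" by simp
      then have "17 * (\<kappa> * (\<epsilon> * D)) - \<kappa>\<^sup>2 * D\<^sup>2 \<le> 289/4 * \<epsilon>\<^sup>2"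
        by (simp add: power2_eq_square algebra_simps)
      moreover have "0 \<le> \<epsilon>\<^sup>2" by simp
      ultimately show ?thesis by linarith
    qed
    ultimately show ?thesis by (simp add: \<epsilon>_def inverse_eq_divide)
  qed
  have bound: "1 - 1 / (1 + (norm (w p))\<^sup>2) \<le> 73 * (norm (gu q))\<^sup>2" for q
  proof (rule tendsto_lowerbound)
    let ?F = "\<lambda>\<kappa>. 73 * (norm (gu q))\<^sup>2 + \<kappa> * (u p - u q) + \<kappa>\<^sup>2 * ((norm (p - q))\<^sup>2 + 4)"
    have "(?F \<longlongrightarrow> 73 * (norm (gu q))\<^sup>2 + 0 * (u p - u q) + 0\<^sup>2 * ((norm (p - q))\<^sup>2 + 4)) (at_right 0)"
      by (intro tendsto_intros)
    then show "(?F \<longlongrightarrow> 73 * (norm (gu q))\<^sup>2) (at_right 0)" by simp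
    show "\<forall>\<^sub>F \<kappa> in at_right 0. 1 - 1 / (1 + (norm (w p))\<^sup>2) \<le> ?F \<kappa>"
      using key by (auto simp: eventually_at_right_field intro!: exI[of _ 1])
  qed simp
  have "1 - 1 / (1 + (norm (w p))\<^sup>2) \<le> 0"
  proof (rule field_le_epsilon)
    fix \<delta> :: real assume "\<delta> > 0"
    then obtain q where "norm (gu q) < sqrt (\<delta> / 73)" using inf0[of "sqrt (\<delta> / 73)"] by auto
    then have "(norm (gu q))\<^sup>2 < \<delta> / 73" using real_less_rsqrt
      by (metis abs_norm_cancel real_sqrt_abs real_sqrt_less_iff)
    then show "1 - 1 / (1 + (norm (w p))\<^sup>2) \<le> 0 + \<delta>" using bound[of q] by simp
  qed
  then have "1 + (norm (w p))\<^sup>2 \<le> 1" by (simp add: field_simps add_pos_nonneg)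
  then show ?thesis by (simp add: w_def)
qed

lemma bounded_below_imp_inf_norm_grad_eq_0:
  fixes f :: "'a::{real_inner, complete_space} \<Rightarrow> real"
  assumes grad: "\<And>x. GDERIV f x :> g x" and bdd: "bdd_below (range f)"
  shows "(INF x. norm (g x)) = 0"
proof (rule antisym)
  have b: "bdd_below (range (\<lambda>x. norm (g x)))" by (auto intro!: bdd_belowI[of _ 0])
  show "(INF x. norm (g x)) \<le> 0"
  proof (rule field_le_epsilon)
    fix \<sigma> :: real assume "\<sigma> > 0"
    obtain x where x: "\<And>h. \<bar>inner h (g x)\<bar> \<le> \<sigma> * norm h"
      using almost_critical_point[OF grad[unfolded gderiv_def] bdd \<open>\<sigma> > 0\<close>] by metis
    have "norm (g x) * norm (g x) \<le> \<sigma> * norm (g x)"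
      using x[of "g x"] by (simp flip: power2_norm_eq_inner power2_eq_square)
    then have "norm (g x) \<le> \<sigma>" using \<open>\<sigma> > 0\<close> by (cases "g x = 0") auto
    then show "(INF x. norm (g x)) \<le> 0 + \<sigma>" using cINF_lower[OF b, of x] by simp
  qed
  show "0 \<le> (INF x. norm (g x))" by (intro cINF_greatest) auto
qed

theorem theorem3p8:
  fixes \<psi>\<^sub>1 \<psi>\<^sub>2 :: "'a::{real_inner, complete_space} \<Rightarrow> real"
  assumes "convex_on UNIV \<psi>\<^sub>1" and "convex_on UNIV \<psi>\<^sub>2"
    and "C2 \<psi>\<^sub>1" and "C2 \<psi>\<^sub>2"
    and "\<forall>z. norm (grad \<psi>\<^sub>1 z) = norm (grad \<psi>\<^sub>2 z)"
  shows "((INF z. norm (grad \<psi>\<^sub>1 z)) = 0 \<longrightarrow> (\<exists>c::real. \<forall>z. \<psi>\<^sub>1 z = \<psi>\<^sub>2 z + c)) \<and>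
    (bdd_below (range \<psi>\<^sub>1) \<or> bdd_below (range \<psi>\<^sub>2) \<longrightarrow> (INF z. norm (grad \<psi>\<^sub>1 z)) = 0)"
proof (intro conjI impI)
  obtain H\<^sub>1 where 1: "\<And>x. GDERIV \<psi>\<^sub>1 x :> grad \<psi>\<^sub>1 x" "\<And>x. (grad \<psi>\<^sub>1 has_derivative H\<^sub>1 x) (at x)"
    "\<And>x h k. inner (H\<^sub>1 x h) k = inner (H\<^sub>1 x k) h" using C2_grad_Hessian[OF assms(3)] by blast
  obtain H\<^sub>2 where 2: "\<And>x. GDERIV \<psi>\<^sub>2 x :> grad \<psi>\<^sub>2 x" "\<And>x. (grad \<psi>\<^sub>2 has_derivative H\<^sub>2 x) (at x)"
    "\<And>x h k. inner (H\<^sub>2 x h) k = inner (H\<^sub>2 x k) h" using C2_grad_Hessian[OF assms(4)] by blast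
  {
    assume "bdd_below (range \<psi>\<^sub>1) \<or> bdd_below (range \<psi>\<^sub>2)"
    then show "(INF z. norm (grad \<psi>\<^sub>1 z)) = 0"
      using bounded_below_imp_inf_norm_grad_eq_0[OF 1(1)] bounded_below_imp_inf_norm_grad_eq_0[OF 2(1)]
        assms(5) by auto
  }
  assume inf0: "(INF z. norm (grad \<psi>\<^sub>1 z)) = 0"
  have "\<exists>q. norm (grad \<psi>\<^sub>1 q) < e" if "e > 0" for e
    using cInf_lessD[of "range (\<lambda>z. norm (grad \<psi>\<^sub>1 z))" e] inf0 that by auto
  then have "grad \<psi>\<^sub>1 z = grad \<psi>\<^sub>2 z" for z
    using equal_gradient_norms_imp_equal_gradients[OF assms(1,2) 1(1) 2(1) 1(2) 2(2) 1(3) 2(3)] assms(5)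
    by blast
  then have "((\<lambda>z. \<psi>\<^sub>1 z - \<psi>\<^sub>2 z) has_derivative (\<lambda>h. 0)) (at z within UNIV)" for z
    using has_derivative_diff[OF 1(1)[of z, unfolded gderiv_def] 2(1)[of z, unfolded gderiv_def]] by simp
  then obtain c where "\<And>z. \<psi>\<^sub>1 z - \<psi>\<^sub>2 z = c"
    using has_derivative_zero_constant[OF convex_UNIV, of "\<lambda>z. \<psi>\<^sub>1 z - \<psi>\<^sub>2 z"] by auto
  then show "\<exists>c. \<forall>z. \<psi>\<^sub>1 z = \<psi>\<^sub>2 z + c" by (intro exI[of _ c]) (simp add: algebra_simps)
qed

end
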